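(* Let $p$ be a prime, let $n\ge 1$, and let $\alpha_1,\alpha_2,\dots,\alpha_n,\beta\ge 1$ be integers. Put $\alpha_{\max}:=\max_{1\le j\le n}\alpha_j$. Then every map $$f\colon \mathbb{Z}_{p^{\alpha_1}}\times\mathbb{Z}_{p^{\alpha_2}}\times\dots\times\mathbb{Z}_{p^{\alpha_n}}\to\mathbb{Z}_{p^\beta}$$ satisfies $$\mathrm{Fdeg}(f)\ \le\ \sum_{j=1}^n p^{\alpha_j}-n+(\beta-1)(p-1)p^{\alpha_{\max}-1},$$ and this upper bound is best possible, i.e. it is attained by some such map $f$.
   Context: Here $\mathbb{Z}_q=\mathbb{Z}/q\mathbb{Z}$. For commutative groups $A,B$, a map $f\colon A\to B$ and $g\in A$, the difference operator $\Delta_g$ is defined by $[\Delta_g f](x):=f(x+g)-f(x)$. Let $G$ be a generating subset of $A$. The functional degree $\mathrm{Fdeg}(f)$ is the smallest integer $m\ge 0$ such that $\Delta_{g_1}\Delta_{g_2}\cdots\Delta_{g_{m+1}}f\equiv 0$ for all $g_1,\dots,g_{m+1}\in G$, if such an $m$ exists, and $\mathrm{Fdeg}(f)=\infty$ otherwise; this value does not depend on the choice of the generating set $G$ (one may take $G=A$). In particular $\mathrm{Fdeg}(0)=0$. *)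

theory Defs
  imports
    "HOL-Algebra.Product_Groups"
    "HOL-Computational_Algebra.Primes"
    "HOL-Library.Extended_Nat"
begin

text \<open>
  The commutative groups are written multiplicatively, following HOL-Algebra, so the zero map
  is the constant map with value \<open>\<one>\<^bsub>B\<^esub>\<close>. Only the values of a map on \<open>carrier A\<close> matter.
\<close>

definition diff_op ::
  "('a, 'c) monoid_scheme \<Rightarrow> ('b, 'd) monoid_scheme \<Rightarrow> 'a \<Rightarrow> ('a \<Rightarrow> 'b) \<Rightarrow> 'a \<Rightarrow> 'b" where
  "diff_op A B g f = (\<lambda>x. f (x \<otimes>\<^bsub>A\<^esub> g) \<otimes>\<^bsub>B\<^esub> inv\<^bsub>B\<^esub> (f x))"

definition iterated_diffs_vanish ::
  "('a, 'c) monoid_scheme \<Rightarrow> ('b, 'd) monoid_scheme \<Rightarrow> nat \<Rightarrow> ('a \<Rightarrow> 'b) \<Rightarrow> bool" where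
  "iterated_diffs_vanish A B k f \<longleftrightarrow>
     (\<forall>gs. length gs = k \<and> set gs \<subseteq> carrier A \<longrightarrow>
        (\<forall>x \<in> carrier A. foldr (diff_op A B) gs f x = \<one>\<^bsub>B\<^esub>))"

text \<open>
  The functional degree does not depend on the generating set from which the
  directions of the differences are taken; here it is the whole group.
\<close>

definition Fdeg ::
  "('a, 'c) monoid_scheme \<Rightarrow> ('b, 'd) monoid_scheme \<Rightarrow> ('a \<Rightarrow> 'b) \<Rightarrow> enat" where
  "Fdeg A B f =
     (if \<exists>m. iterated_diffs_vanish A B (m + 1) f
      then enat (LEAST m. iterated_diffs_vanish A B (m + 1) f)
      else \<infinity>)"

end

theory Submission
  imports Defs "HOL-Library.Function_Algebras"
begin

text \<open>
  Every map \<open>f\<close> on the product of the cyclic groups lifts to an integer-valued function \<open>F\<close> of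
  \<open>x :: nat \<Rightarrow> nat\<close> that has period \<open>q\<^sub>j = p ^ \<alpha> j\<close> in the coordinate \<open>j\<close>, and iterated differences of \<open>f\<close>
  vanish exactly if those of \<open>F\<close> are divisible by \<open>p ^ \<beta>\<close> (\<open>iterated_diffs_vanish_iff\<close>).
  So the question is how divisible by \<open>p\<close> the differences of a periodic integer function become.

  In one variable, put \<open>q = p ^ a\<close> and \<open>\<phi> = q - p ^ (a - 1)\<close>, Euler's totient of \<open>q\<close>. With \<open>\<Delta>\<close> the
  difference operator, periodicity says \<open>(1 + \<Delta>) ^ q = 1\<close>, that is,
  \<open>\<Delta> ^ q = - (\<Sum>0<i<q. (q choose i) \<Delta> ^ i)\<close>. The coefficient of \<open>\<Delta> ^ i\<close> is divisible by some \<open>p ^ s\<close>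
  with \<open>s \<ge> 1\<close> and \<open>p ^ (a - s) \<le> i\<close>. Give \<open>\<Delta>\<close> the weight 1 and \<open>p\<close> the weight \<open>\<phi>\<close>: the terms on the right
  have weight at least \<open>s * \<phi> + p ^ (a - s) \<ge> q\<close>, so rewriting with this relation never loses weight.
  Hence \<open>p ^ b\<close> divides \<open>\<Delta> ^ k\<close> as soon as \<open>k \<ge> p ^ (a - 1) + b * \<phi>\<close>
  (\<open>power_dvd_if_binomial_recurrence\<close>). Moreover, only the term with
  \<open>i = p ^ (a - 1)\<close> has weight exactly \<open>q\<close>, and \<open>p\<close> divides its coefficient exactly once. So lowering the
  exponent by \<open>\<phi>\<close> in \<open>\<Delta> ^ (q - 1 + b * \<phi>)\<close> costs exactly one factor \<open>p\<close>, and if \<open>p\<close> does not divide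
  \<open>\<Delta> ^ (q - 1)\<close> at some point, then \<open>p ^ (b + 1)\<close> does not divide \<open>\<Delta> ^ (q - 1 + b * \<phi>)\<close> there
  (\<open>power_not_dvd_if_binomial_recurrence\<close>).

  In several variables the powers of \<open>p\<close> gained in the separate coordinates multiply
  (\<open>prime_power_dvd_foldr_fdiff\<close>). To take many differences with \<open>b\<^sub>j\<close> factors \<open>p\<close> gained in the coordinate
  \<open>j\<close>, one can take at most \<open>q\<^sub>j - 1 + b\<^sub>j * \<phi>\<^sub>j\<close> of them there, and \<open>\<phi>\<^sub>j\<close> is largest where \<open>\<alpha> j\<close> is. With fewer
  than \<open>\<beta>\<close> factors in total this gives at most the stated bound (\<open>sum_valuations_ge\<close>). Differences in
  arbitrary directions reduce to differences in coordinate directions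
  (\<open>dvd_foldr_fdiff_if_dvd_unit_vecs\<close>).

  The bound is attained by the indicator function of the point whose coordinates are all \<open>-1\<close>. It is
  a product of functions of one variable, so its differences factor (\<open>foldr_fdiff_prod\<close>). Taking
  \<open>q\<^sub>j - 1\<close> differences at 0 in each coordinate gives 1, and \<open>(\<beta> - 1) * \<phi>\<close> further ones in a
  coordinate with the largest \<open>\<alpha> j\<close> contribute only \<open>\<beta> - 1\<close> factors \<open>p\<close>.
\<close>

section \<open>Forward differences of integer-valued functions\<close>

definition fdiff :: "'a::comm_monoid_add \<Rightarrow> ('a \<Rightarrow> int) \<Rightarrow> 'a \<Rightarrow> int" where
  "fdiff g F = (\<lambda>x. F (x + g) - F x)"

lemma fdiff_commute: "fdiff g (fdiff h F) = fdiff h (fdiff g F)"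
  by (simp add: fdiff_def fun_eq_iff algebra_simps)

lemma foldr_fdiff_commute: "foldr fdiff gs (fdiff h F) = fdiff h (foldr fdiff gs F)"
  by (induction gs) (simp_all add: fdiff_commute)

lemma foldr_fdiff_mset_cong:
  "mset gs = mset hs \<Longrightarrow> foldr fdiff gs F = foldr fdiff hs F"
proof (induction gs arbitrary: hs)
  case (Cons g gs)
  then have "g \<in> set hs"
    using mset_eq_setD by fastforce
  then obtain xs ys where hs: "hs = xs @ g # ys"
    by (meson split_list)
  then have "foldr fdiff gs F = foldr fdiff (xs @ ys) F"
    using Cons.prems by (intro Cons.IH) simp
  then show ?case
    by (simp add: hs foldr_fdiff_commute)
qed simp

lemma foldr_fdiff_replicate: "foldr fdiff (replicate m g) F = (fdiff g ^^ m) F"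
  by (induction m) simp_all

text \<open>
  This is the expansion of \<open>(1 + \<Delta>) ^ q\<close>, where \<open>1 + \<Delta>\<close> is the translation by \<open>g\<close>.
\<close>

lemma newton_forward:
  "F (((+) g ^^ q) x) = (\<Sum>i\<le>q. int (q choose i) * (fdiff g ^^ i) F x)"
proof (induction q arbitrary: F)
  case (Suc q)
  have "F (((+) g ^^ Suc q) x) = F (((+) g ^^ q) x) + fdiff g F (((+) g ^^ q) x)"
    by (simp add: fdiff_def add.commute)
  also have "\<dots> = (\<Sum>i\<le>q. int (q choose i) * (fdiff g ^^ i) F x)
      + (\<Sum>i\<le>q. int (q choose i) * (fdiff g ^^ Suc i) F x)"
    by (simp add: Suc funpow_swap1)
  also have "(\<Sum>i\<le>q. int (q choose i) * (fdiff g ^^ i) F x)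
      = F x + (\<Sum>i\<le>q. int (q choose Suc i) * (fdiff g ^^ Suc i) F x)"
  proof -
    have "(\<Sum>i\<le>q. int (q choose i) * (fdiff g ^^ i) F x)
        = (\<Sum>i\<le>Suc q. int (q choose i) * (fdiff g ^^ i) F x)"
      by simp
    then show ?thesis
      by (simp only: sum.atMost_Suc_shift) simp
  qed
  also have "F x + (\<Sum>i\<le>q. int (q choose Suc i) * (fdiff g ^^ Suc i) F x)
        + (\<Sum>i\<le>q. int (q choose i) * (fdiff g ^^ Suc i) F x)
      = F x + (\<Sum>i\<le>q. int (Suc q choose Suc i) * (fdiff g ^^ Suc i) F x)"
    by (simp add: sum.distrib algebra_simps)
  also have "\<dots> = (\<Sum>i\<le>Suc q. int (Suc q choose i) * (fdiff g ^^ i) F x)"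
    by (simp only: sum.atMost_Suc_shift) simp
  finally show ?case .
qed simp

section \<open>Divisibility by powers of a prime in one variable\<close>

text \<open>
  With \<open>S\<close> the shift of sequences, this says \<open>((1 + S) ^ q - 1) c = 0\<close>. The differences
  \<open>c m = \<Delta> ^ m F x\<close> of a \<open>q\<close>-periodic function at a fixed point satisfy it. Working with these sequences
  separates the arithmetic from the functions, and the recurrence survives division of
  \<open>c\<close> by a common divisor.
\<close>

definition binomial_recurrence :: "nat \<Rightarrow> (nat \<Rightarrow> int) \<Rightarrow> bool" where
  "binomial_recurrence q c \<longleftrightarrow> (\<forall>m. (\<Sum>i=1..q. int (q choose i) * c (m + i)) = 0)"

lemma periodic_foldr_fdiff:
  assumes "\<And>x. F (((+) g ^^ q) x) = F x"
  shows "foldr fdiff hs F (((+) g ^^ q) x) = foldr fdiff hs F x"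
proof -
  have *: "((+) g ^^ q) x + h = ((+) g ^^ q) (x + h)" for x h
    by (induction q) (simp_all add: add.assoc)
  show ?thesis
    by (induction hs arbitrary: x) (simp_all add: assms fdiff_def *)
qed

text \<open>
  The first \<open>m\<close> differences are again periodic, and then Newton's expansion of \<open>F (x + q g) = F x\<close> has all
  terms but the first summing to zero. The differences along \<open>hs\<close> allow the use of the
  recurrence in one coordinate after differences in the others.
\<close>

lemma binomial_recurrence_differences:
  assumes "\<And>x. F (((+) g ^^ q) x) = F x"
  shows "binomial_recurrence q (\<lambda>m. foldr fdiff (replicate m g @ hs) F x)"
  unfolding binomial_recurrence_def
proof
  fix m
  define H where "H = foldr fdiff (replicate m g @ hs) F"
  have "H (((+) g ^^ q) x) = H x"
    unfolding H_def by (rule periodic_foldr_fdiff) (rule assms)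
  then have "H x = (\<Sum>i\<le>q. int (q choose i) * (fdiff g ^^ i) H x)"
    using newton_forward[of H q g x] by simp
  also have "\<dots> = H x + (\<Sum>i=1..q. int (q choose i) * (fdiff g ^^ i) H x)"
    by (simp add: sum.atLeast_Suc_atMost atMost_atLeast0)
  finally have "(\<Sum>i=1..q. int (q choose i) * (fdiff g ^^ i) H x) = 0"
    by simp
  moreover have "(fdiff g ^^ i) H = foldr fdiff (replicate (m + i) g @ hs) F" for i
    by (simp add: H_def foldr_fdiff_replicate funpow_add add.commute[of m])
  ultimately show "(\<Sum>i=1..q. int (q choose i) * foldr fdiff (replicate (m + i) g @ hs) F x) = 0"
    by simp
qed

text \<open>
  From \<open>i * (p ^ a choose i) = p ^ a * (p ^ a - 1 choose (i - 1))\<close>, the exponent of \<open>p\<close> in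
  \<open>p ^ a choose i\<close> is at least \<open>s = a - v\<close>, where \<open>v\<close> is the exponent in \<open>i\<close>; and \<open>p ^ v \<le> i\<close>. That last
  inequality is the only trace of \<open>v\<close> that the weight estimates need.
\<close>

lemma prime_power_binomial_dvd:
  assumes "prime (p::nat)" "0 < i" "i < p ^ a"
  obtains s where "1 \<le> s" "s \<le> a" "p ^ s dvd (p ^ a choose i)" "p ^ (a - s) \<le> i"
proof -
  define v where "v = multiplicity p i"
  have "p ^ v dvd i"
    by (simp add: v_def multiplicity_dvd)
  then have le: "p ^ v \<le> i"
    using assms dvd_imp_le by blast
  then have "p ^ v < p ^ a"
    using assms by simp
  then have "v < a"
    using assms(1) prime_gt_1_nat power_less_imp_less_exp by blast
  obtain w where w: "i = p ^ v * w" "\<not> p dvd w"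
    using multiplicity_decompose'[of i p] assms not_prime_unit[of p] unfolding v_def by blast
  have "p ^ a * (p ^ a - 1 choose (i - 1)) = i * (p ^ a choose i)"
    using assms times_binomial_minus1_eq by simp
  then have "p ^ v * p ^ (a - v) dvd p ^ v * (w * (p ^ a choose i))"
    using \<open>v < a\<close> w by (metis dvd_triv_left le_add_diff_inverse less_imp_le mult.assoc power_add)
  then have "p ^ (a - v) dvd w * (p ^ a choose i)"
    using assms by (simp add: prime_gt_0_nat)
  moreover have "coprime (p ^ (a - v)) w"
    using assms w by (simp add: prime_imp_coprime)
  ultimately have "p ^ (a - v) dvd (p ^ a choose i)"
    using coprime_dvd_mult_right_iff by blast
  then show thesis
    using that[of "a - v"] \<open>v < a\<close> le by simp
qed

text \<open>
  This combines the factors \<open>p ^ s\<close> of the binomial coefficient with those of \<open>y\<close>, for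
  each term of the recurrence.
\<close>

lemma power_dvd_binomial_mult:
  assumes p: "prime p" and i: "0 < i" "i < p ^ a"
    and y: "\<And>s. 1 \<le> s \<Longrightarrow> s < b \<Longrightarrow> p ^ (a - s) \<le> i \<Longrightarrow> int p ^ (b - s) dvd y"
  shows "int p ^ b dvd int (p ^ a choose i) * y"
proof -
  obtain s where s: "1 \<le> s" "s \<le> a" "p ^ s dvd (p ^ a choose i)" "p ^ (a - s) \<le> i"
    using prime_power_binomial_dvd[OF p i] .
  have "int p ^ (b - s) dvd y"
    using y s by (cases "s < b") auto
  moreover have "int p ^ s dvd int (p ^ a choose i)"
    using s(3) by (metis int_dvd_int_iff of_nat_power)
  ultimately have "int p ^ s * int p ^ (b - s) dvd int (p ^ a choose i) * y"
    by (intro mult_dvd_mono)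
  moreover have "int p ^ b dvd int p ^ s * int p ^ (b - s)"
    by (simp add: le_imp_power_dvd flip: power_add)
  ultimately show ?thesis
    using dvd_trans by blast
qed

lemma power_eq_pred_power_plus:
  assumes "0 < (p::nat)" "1 \<le> a"
  shows "p ^ a = p ^ (a - 1) + (p - 1) * p ^ (a - 1)"
  using assms by (cases a; cases p) simp_all

text \<open>
  The induction rewrites \<open>c k\<close> by the recurrence. A term with \<open>s = 1\<close> keeps its weight because
  \<open>i \<ge> p ^ (a - 1)\<close>; a term with \<open>s \<ge> 2\<close> does so for the crude reason \<open>p ^ (a - 1) \<le> \<phi>\<close>.
\<close>

lemma power_dvd_if_binomial_recurrence:
  assumes p: "prime p" and a: "1 \<le> a" and c: "binomial_recurrence (p ^ a) c"
  shows "p ^ (a - 1) + b * ((p - 1) * p ^ (a - 1)) \<le> k \<Longrightarrow> int p ^ b dvd c k"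
proof (induction k arbitrary: b rule: less_induct)
  case (less k)
  define \<phi> where "\<phi> = (p - 1) * p ^ (a - 1)"
  have q: "p ^ a = p ^ (a - 1) + \<phi>"
    unfolding \<phi>_def by (rule power_eq_pred_power_plus[OF prime_gt_0_nat[OF p] a])
  have \<phi>: "p ^ (a - 1) \<le> \<phi>"
    using prime_ge_2_nat[OF p] by (simp add: \<phi>_def)
  show ?case
  proof (cases b)
    case (Suc b')
    define m where "m = k - p ^ a"
    have k: "k = m + p ^ a"
      using less.prems by (simp add: m_def Suc q \<phi>_def)
    have m: "b' * \<phi> \<le> m"
      using less.prems unfolding \<phi>_def[symmetric] k q Suc by simp
    have "int p ^ b dvd int (p ^ a choose i) * c (m + i)" if i: "i \<in> {1..<p ^ a}" for i
    proof (rule power_dvd_binomial_mult[OF p])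
      fix s assume s: "1 \<le> s" "s < b" "p ^ (a - s) \<le> i"
      have "p ^ (a - 1) + (b - s) * \<phi> \<le> m + i"
      proof (cases "s = 1")
        case True
        then show ?thesis using m s Suc by simp
      next
        case False
        then have "p ^ (a - 1) + (b - s) * \<phi> \<le> \<phi> + (b - s) * \<phi>" using \<phi> by simp
        also have "\<dots> = (b - s + 1) * \<phi>" by simp
        also have "\<dots> \<le> b' * \<phi>" using Suc False s by (intro mult_right_mono) auto
        finally show ?thesis using m by simp
      qed
      then show "int p ^ (b - s) dvd c (m + i)"
        using less.IH[of "m + i" "b - s"] i k by (auto simp: \<phi>_def)
    qed (use i in auto)
    then have "int p ^ b dvd (\<Sum>i\<in>{1..<p ^ a}. int (p ^ a choose i) * c (m + i))"
      by (intro dvd_sum) auto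
    moreover have "c k = - (\<Sum>i\<in>{1..<p ^ a}. int (p ^ a choose i) * c (m + i))"
    proof -
      have "0 = (\<Sum>i\<in>{1..p ^ a}. int (p ^ a choose i) * c (m + i))"
        using c by (simp add: binomial_recurrence_def)
      also have "{1..p ^ a} = insert (p ^ a) {1..<p ^ a}"
        using prime_gt_0_nat[OF p] by (auto simp: Suc_le_eq)
      finally show ?thesis
        by (simp add: k)
    qed
    ultimately show ?thesis
      by simp
  qed simp
qed

text \<open>
  Modulo \<open>p\<close> the row \<open>p ^ a - 1\<close> of Pascal's triangle alternates between 1 and -1, because the row below
  it vanishes strictly between its ends.
\<close>

lemma prime_not_dvd_binomial_pred:
  assumes "prime (p::nat)" "i < p ^ a"
  shows "\<not> p dvd (p ^ a - 1 choose i)"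
  using assms(2)
proof (induction i)
  case 0
  then show ?case using assms(1) not_prime_unit by auto
next
  case (Suc i)
  obtain s where "1 \<le> s" "p ^ s dvd (p ^ a choose Suc i)"
    using prime_power_binomial_dvd[OF assms(1), of "Suc i" a] Suc by auto
  then have "p dvd (p ^ a choose Suc i)"
    using dvd_power_le[of p p 1 s] by (metis dvd_refl dvd_trans power_one_right)
  moreover have "p ^ a choose Suc i = (p ^ a - 1 choose i) + (p ^ a - 1 choose Suc i)"
    using Suc.prems by (metis binomial_Suc_Suc Suc_diff_1 less_trans zero_less_Suc)
  ultimately show ?case
    using Suc by (metis Suc_lessD dvd_add_left_iff)
qed

text \<open>
  In the recurrence for \<open>c (q - 1 + (b + 1) * \<phi>)\<close>, \<open>power_dvd_if_binomial_recurrence\<close> makes every term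
  with \<open>i < q\<close> divisible by \<open>p ^ (b + 2)\<close> except the one with \<open>i = p ^ (a - 1)\<close>. That term is
  \<open>p * (q - 1 choose (p ^ (a - 1) - 1)) * c (q - 1 + b * \<phi>)\<close>, whose binomial coefficient is prime to \<open>p\<close>.
\<close>

lemma power_not_dvd_if_binomial_recurrence:
  assumes p: "prime p" and a: "1 \<le> a" and c: "binomial_recurrence (p ^ a) c"
    and base: "\<not> int p dvd c (p ^ a - 1)"
  shows "\<not> int p ^ Suc b dvd c (p ^ a - 1 + b * ((p - 1) * p ^ (a - 1)))"
proof (induction b)
  case 0
  then show ?case using base by simp
next
  case (Suc b)
  define \<phi> where "\<phi> = (p - 1) * p ^ (a - 1)"
  have q: "p ^ a = p ^ (a - 1) + \<phi>"
    unfolding \<phi>_def by (rule power_eq_pred_power_plus[OF prime_gt_0_nat[OF p] a])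
  have \<phi>: "p ^ (a - 1) \<le> \<phi>"
    using prime_ge_2_nat[OF p] by (simp add: \<phi>_def)
  have pos: "0 < p ^ (a - 1)" using prime_gt_0_nat[OF p] by simp
  define m where "m = Suc b * \<phi> - 1"
  have "0 < \<phi>"
    using \<phi> pos by linarith
  then have m: "Suc b * \<phi> = m + 1"
    by (simp add: m_def)
  \<comment> \<open>The index of the only term that does not gain weight.\<close>
  define r where "r = p ^ (a - 1)"
  have r: "0 < r" "r < p ^ a"
    using pos \<phi> unfolding q r_def by linarith+
  have "int p ^ Suc (Suc b) dvd int (p ^ a choose i) * c (m + i)"
    if i: "i \<in> {1..<p ^ a} - {r}" for i
  proof (rule power_dvd_binomial_mult[OF p])
    fix s assume s: "1 \<le> s" "s < Suc (Suc b)" "p ^ (a - s) \<le> i"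
    have "p ^ (a - 1) + (Suc (Suc b) - s) * \<phi> \<le> m + i"
    proof (cases "s = 1")
      case True
      then show ?thesis using m s i by (simp add: r_def)
    next
      case False
      then have "p ^ (a - 1) + (Suc (Suc b) - s) * \<phi> \<le> \<phi> + (Suc (Suc b) - s) * \<phi>" using \<phi> by simp
      also have "\<dots> = (Suc (Suc b) - s + 1) * \<phi>" by simp
      also have "\<dots> \<le> Suc b * \<phi>" using False s by (intro mult_right_mono) auto
      finally show ?thesis using m i by simp
    qed
    then show "int p ^ (Suc (Suc b) - s) dvd c (m + i)"
      using power_dvd_if_binomial_recurrence[OF p a c] by (simp add: \<phi>_def)
  qed (use i in auto)
  then have rest: "int p ^ Suc (Suc b) dvd (\<Sum>i\<in>{1..<p ^ a} - {r}. int (p ^ a choose i) * c (m + i))"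
    by (intro dvd_sum) auto
  have "0 = (\<Sum>i\<in>{1..p ^ a}. int (p ^ a choose i) * c (m + i))"
    using c by (simp add: binomial_recurrence_def)
  also have "{1..p ^ a} = insert (p ^ a) (insert r ({1..<p ^ a} - {r}))"
    using r by auto
  also have "(\<Sum>i\<in>\<dots>. int (p ^ a choose i) * c (m + i)) =
      c (m + p ^ a) + int (p ^ a choose r) * c (m + r)
        + (\<Sum>i\<in>{1..<p ^ a} - {r}. int (p ^ a choose i) * c (m + i))"
    using r by (subst sum.insert; (subst sum.insert)?) auto
  finally have eq: "c (m + p ^ a) = - (int (p ^ a choose r) * c (m + r))
        - (\<Sum>i\<in>{1..<p ^ a} - {r}. int (p ^ a choose i) * c (m + i))"
    by linarith
  have "p ^ a = r * p"
    using a by (cases a) (simp_all add: r_def)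
  then have "r * (p ^ a choose r) = r * (p * (p ^ a - 1 choose (r - 1)))"
    using times_binomial_minus1_eq[OF r(1), of "p ^ a"] by (simp only: mult.assoc)
  then have binom: "p ^ a choose r = p * (p ^ a - 1 choose (r - 1))"
    using r(1) by simp
  have nd: "\<not> int p dvd int (p ^ a - 1 choose (r - 1))"
    using prime_not_dvd_binomial_pred[OF p, of "r - 1" a] r(2)
    by (simp add: less_imp_diff_less)
  have mr: "m + r = p ^ a - 1 + b * \<phi>"
    using m q \<open>0 < \<phi>\<close> unfolding r_def mult_Suc by linarith
  have mq: "m + p ^ a = p ^ a - 1 + Suc b * \<phi>"
    using m pos q by linarith
  show ?case
    unfolding \<phi>_def[symmetric] mq[symmetric]
  proof
    assume "int p ^ Suc (Suc b) dvd c (m + p ^ a)"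
    then have "int p ^ Suc (Suc b) dvd int (p ^ a choose r) * c (m + r)"
      using rest unfolding eq by (simp add: dvd_diff_left_iff)
    then have "int p ^ Suc b dvd int (p ^ a - 1 choose (r - 1)) * c (m + r)"
      using prime_gt_0_nat[OF p] by (simp add: binom mult.assoc)
    moreover have "coprime (int p ^ Suc b) (int (p ^ a - 1 choose (r - 1)))"
      using nd p by (intro coprime_power_left_iff[THEN iffD2] disjI1 prime_imp_coprime) auto
    ultimately have "int p ^ Suc b dvd c (m + r)"
      using coprime_dvd_mult_right_iff by blast
    then show False
      using Suc by (simp add: mr \<phi>_def)
  qed
qed

section \<open>Differences in several variables\<close>

definition unit_vec :: "'i \<Rightarrow> 'i \<Rightarrow> nat" where
  "unit_vec j = (\<lambda>i. if i = j then 1 else 0)"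

lemma funpow_add_unit_vec: "((+) (unit_vec j) ^^ m) x = x(j := x j + m)"
  by (induction m) (auto simp: unit_vec_def fun_eq_iff plus_fun_def)

text \<open>
  Modulo \<open>M\<close>, a function invariant under unit steps in the coordinates of \<open>J\<close> is invariant under every
  translation composed of such steps.
\<close>

lemma dvd_fdiff_if_dvd_fdiff_unit_vec:
  assumes J: "finite J" and H: "\<And>j x. j \<in> J \<Longrightarrow> M dvd fdiff (unit_vec j) H x"
    and g: "\<And>i. i \<notin> J \<Longrightarrow> g i = 0"
  shows "M dvd fdiff g H x"
  using g
proof (induction "sum g J" arbitrary: g x)
  case 0
  then have "g i = 0" for i
    using J by (cases "i \<in> J") auto
  then have "g = 0"
    by (simp add: fun_eq_iff)
  then show ?case
    unfolding fdiff_def by (simp only: add_0_right diff_self dvd_0_right)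
next
  case (Suc m)
  then obtain j where j: "j \<in> J" "0 < g j"
    by (metis bot_nat_0.not_eq_extremum sum.neutral zero_less_Suc)
  define h where "h = g(j := g j - 1)"
  have g: "g = h + unit_vec j"
    using j by (auto simp: h_def unit_vec_def fun_eq_iff)
  have "sum g J = sum h J + 1"
    using J j by (simp add: g plus_fun_def sum.distrib unit_vec_def)
  then have "M dvd fdiff h H x"
    using Suc by (intro Suc.hyps(1)) (auto simp: h_def)
  moreover have "fdiff g H x = fdiff (unit_vec j) H (x + h) + fdiff h H x"
    by (simp add: fdiff_def g add.assoc)
  ultimately show ?case
    using H[OF j(1)] by simp
qed

text \<open>
  The functional degree may be computed from the generators \<open>unit_vec j\<close>: differences commute, so an
  arbitrary direction can be made the outermost one and replaced by unit steps. The induction keeps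
  some directions \<open>js\<close> already replaced.
\<close>

lemma dvd_foldr_fdiff_if_dvd_unit_vecs:
  assumes J: "finite J"
    and F: "\<And>js x. set js \<subseteq> J \<Longrightarrow> length js = k \<Longrightarrow> M dvd foldr fdiff (map unit_vec js) F x"
    and gs: "\<And>g i. g \<in> set gs \<Longrightarrow> i \<notin> J \<Longrightarrow> g i = 0"
    and "length gs = k"
  shows "M dvd foldr fdiff gs F x"
proof -
  have "M dvd foldr fdiff gs (foldr fdiff (map unit_vec js) F) x"
    if "set js \<subseteq> J" "length gs + length js = k" for js
    using gs that
  proof (induction gs arbitrary: js x)
    case Nil
    then show ?case using F by simp
  next
    case (Cons g gs)
    let ?H = "foldr fdiff gs (foldr fdiff (map unit_vec js) F)"
    have "M dvd fdiff g ?H x"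
    proof (rule dvd_fdiff_if_dvd_fdiff_unit_vec[OF J])
      fix j x assume "j \<in> J"
      then have "M dvd foldr fdiff gs (foldr fdiff (map unit_vec (j # js)) F) x"
        using Cons.prems by (intro Cons.IH) auto
      then show "M dvd fdiff (unit_vec j) ?H x"
        by (simp add: foldr_fdiff_commute)
    qed (use Cons.prems in auto)
    then show ?case by simp
  qed
  from this[of "[]"] show ?thesis
    using assms(4) by simp
qed

text \<open>
  The summand for \<open>j\<close> is the number of factors \<open>p\<close> that the one-variable estimate grants to \<open>k\<close>
  differences in the coordinate \<open>j\<close>, the largest \<open>b\<close> with \<open>p ^ (\<alpha> j - 1) + b * \<phi>\<^sub>j \<le> k\<close>; truncated
  subtraction makes it 0 for small \<open>k\<close>. When a coordinate is added, the number of differences taken in it is left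
  variable: all terms of the resulting sequence share the divisor \<open>d\<close> known from the other coordinates, and the
  sequence divided by \<open>d\<close> satisfies the same recurrence, so the new factors multiply with \<open>d\<close>.
\<close>

lemma prime_power_dvd_foldr_fdiff:
  assumes p: "prime p" and J: "finite J" and \<alpha>: "\<And>j. j \<in> J \<Longrightarrow> 1 \<le> \<alpha> j"
    and per: "\<And>j x. j \<in> J \<Longrightarrow> F (x(j := x j + p ^ \<alpha> j)) = F x"
  shows "int p ^ (\<Sum>j\<in>J. (count_list js j - p ^ (\<alpha> j - 1)) div ((p - 1) * p ^ (\<alpha> j - 1)))
           dvd foldr fdiff (map unit_vec js) F x"
  using J \<alpha> per
proof (induction J arbitrary: js rule: finite_induct)
  case (insert j J)
  define b where "b k i = (k - p ^ (\<alpha> i - 1)) div ((p - 1) * p ^ (\<alpha> i - 1))" for k i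
  define d where "d = int p ^ (\<Sum>i\<in>J. b (count_list js i) i)"
  define rest where "rest = filter (\<lambda>i. i \<noteq> j) js"
  define c where "c m = foldr fdiff (replicate m (unit_vec j) @ map unit_vec rest) F x" for m
  have count: "count_list (replicate m j @ rest) i = count_list js i" if "i \<noteq> j" for i m
  proof -
    have "count_list rest i = count_list js i"
      unfolding rest_def using that by (induction js) auto
    then show ?thesis
      using that by (simp add: count_notin)
  qed
  have d: "d dvd c m" for m
  proof -
    have "int p ^ (\<Sum>i\<in>J. b (count_list (replicate m j @ rest) i) i)
            dvd foldr fdiff (map unit_vec (replicate m j @ rest)) F x"
      unfolding b_def using insert.prems by (intro insert.IH) auto
    also have "(\<Sum>i\<in>J. b (count_list (replicate m j @ rest) i) i) = (\<Sum>i\<in>J. b (count_list js i) i)"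
      using insert.hyps by (metis (no_types, lifting) count sum.cong)
    finally show ?thesis
      by (simp add: c_def d_def map_replicate)
  qed
  have "d \<noteq> 0"
    using prime_gt_0_nat[OF p] by (simp add: d_def)
  have "binomial_recurrence (p ^ \<alpha> j) c"
    unfolding c_def
    by (intro binomial_recurrence_differences) (subst funpow_add_unit_vec, rule insert.prems(2), simp)
  then have "binomial_recurrence (p ^ \<alpha> j) (\<lambda>m. c m div d)"
    unfolding binomial_recurrence_def
  proof (intro allI)
    fix m assume c: "\<forall>m. (\<Sum>i = 1..p ^ \<alpha> j. int (p ^ \<alpha> j choose i) * c (m + i)) = 0"
    have "d * (\<Sum>i = 1..p ^ \<alpha> j. int (p ^ \<alpha> j choose i) * (c (m + i) div d))
        = (\<Sum>i = 1..p ^ \<alpha> j. int (p ^ \<alpha> j choose i) * c (m + i))"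
      unfolding sum_distrib_left using d by (intro sum.cong) (auto simp: mult.left_commute[of d])
    then show "(\<Sum>i = 1..p ^ \<alpha> j. int (p ^ \<alpha> j choose i) * (c (m + i) div d)) = 0"
      using c \<open>d \<noteq> 0\<close> by simp
  qed
  then have div: "int p ^ b k j dvd c k div d" for k
  proof (cases "b k j = 0")
    case False
    then have "p ^ (\<alpha> j - 1) \<le> k"
      unfolding b_def by (metis diff_is_0_eq div_0 nat_le_linear)
    moreover have "b k j * ((p - 1) * p ^ (\<alpha> j - 1)) \<le> k - p ^ (\<alpha> j - 1)"
      unfolding b_def by (rule div_times_less_eq_dividend)
    ultimately have "p ^ (\<alpha> j - 1) + b k j * ((p - 1) * p ^ (\<alpha> j - 1)) \<le> k"
      by linarith
    then show ?thesis
      using \<open>binomial_recurrence (p ^ \<alpha> j) (\<lambda>m. c m div d)\<close> insert.prems(1)[of j]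
      by (intro power_dvd_if_binomial_recurrence[OF p]) auto
  qed simp
  let ?k = "count_list js j"
  have "mset (replicate ?k (unit_vec j) @ map unit_vec rest) = mset (map unit_vec js)"
    unfolding rest_def by (induction js) auto
  then have "c ?k = foldr fdiff (map unit_vec js) F x"
    unfolding c_def by (metis foldr_fdiff_mset_cong)
  moreover have "int p ^ b ?k j * d dvd c ?k"
    using div[of ?k] d[of ?k] \<open>d \<noteq> 0\<close> by (metis dvd_div_mult_self dvd_refl mult_dvd_mono)
  moreover have "int p ^ b ?k j * d = int p ^ (\<Sum>i\<in>insert j J. b (count_list js i) i)"
    using insert.hyps by (simp add: d_def power_add)
  ultimately show ?case
    by (simp add: b_def)
qed simp

text \<open>
  By division with remainder, \<open>k j \<le> p ^ \<alpha> j - 1 + b\<^sub>j * \<phi>\<^sub>j\<close> for the quotient \<open>b\<^sub>j\<close>, and \<open>\<phi>\<^sub>j\<close> is at most its value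
  for the exponent \<open>a\<close>. Summing over \<open>j\<close> leaves room for the given total only if the \<open>b\<^sub>j\<close> sum to \<open>\<beta>\<close> or more.
\<close>

lemma sum_valuations_ge:
  fixes p \<beta> a :: nat and \<alpha> k :: "'i \<Rightarrow> nat"
  assumes p: "prime p" and J: "finite J" and \<alpha>: "\<And>j. j \<in> J \<Longrightarrow> 1 \<le> \<alpha> j" "\<And>j. j \<in> J \<Longrightarrow> \<alpha> j \<le> a"
    and k: "(\<Sum>j\<in>J. k j) = (\<Sum>j\<in>J. p ^ \<alpha> j) - card J + (\<beta> - 1) * (p - 1) * p ^ (a - 1) + 1"
  shows "\<beta> \<le> (\<Sum>j\<in>J. (k j - p ^ (\<alpha> j - 1)) div ((p - 1) * p ^ (\<alpha> j - 1)))"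
proof -
  define \<phi> where "\<phi> = (p - 1) * p ^ (a - 1)"
  define b where "b j = (k j - p ^ (\<alpha> j - 1)) div ((p - 1) * p ^ (\<alpha> j - 1))" for j
  have "k j + 1 \<le> p ^ \<alpha> j + b j * \<phi>" if j: "j \<in> J" for j
  proof -
    let ?\<psi> = "(p - 1) * p ^ (\<alpha> j - 1)"
    have "0 < ?\<psi>"
      using prime_gt_1_nat[OF p] by simp
    then have "k j - p ^ (\<alpha> j - 1) < ?\<psi> + b j * ?\<psi>"
      unfolding b_def by (simp add: dividend_less_div_times)
    then have "k j + 1 \<le> p ^ (\<alpha> j - 1) + ?\<psi> + b j * ?\<psi>"
      by linarith
    also have "p ^ (\<alpha> j - 1) + ?\<psi> = p ^ \<alpha> j"
      using \<alpha>(1)[OF j] prime_gt_0_nat[OF p] by (cases "\<alpha> j"; cases p) simp_all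
    also have "b j * ?\<psi> \<le> b j * \<phi>"
      using \<alpha>(2)[OF j] prime_gt_0_nat[OF p] by (auto simp: \<phi>_def intro!: mult_left_mono power_increasing)
    finally show ?thesis by simp
  qed
  then have "(\<Sum>j\<in>J. k j + 1) \<le> (\<Sum>j\<in>J. p ^ \<alpha> j + b j * \<phi>)"
    by (rule sum_mono)
  then have "(\<Sum>j\<in>J. k j) + card J \<le> (\<Sum>j\<in>J. p ^ \<alpha> j) + (\<Sum>j\<in>J. b j) * \<phi>"
    unfolding sum.distrib sum_distrib_right[symmetric] by simp
  moreover have "(\<Sum>j\<in>J. 1) \<le> (\<Sum>j\<in>J. p ^ \<alpha> j)"
    using prime_gt_0_nat[OF p] by (intro sum_mono) (simp add: Suc_le_eq)
  ultimately have "(\<beta> - 1) * \<phi> < (\<Sum>j\<in>J. b j) * \<phi>"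
    using k[unfolded mult.assoc, folded \<phi>_def] unfolding sum_constant by linarith
  then have "\<beta> - 1 < (\<Sum>j\<in>J. b j)"
    by simp
  then show ?thesis
    unfolding b_def by linarith
qed

lemma ex_list_with_counts:
  "finite J \<Longrightarrow> \<exists>js. set js \<subseteq> J \<and> (\<forall>j\<in>J. count_list js j = k j)"
proof (induction rule: finite_induct)
  case (insert j J)
  then obtain js where js: "set js \<subseteq> J" "\<forall>i\<in>J. count_list js i = k i" by blast
  have "count_list (replicate (k j) j @ js) i = k i" if "i \<in> insert j J" for i
  proof (cases "i = j")
    case True
    then have "count_list js i = 0" using insert js by (auto simp: count_list_0_iff)
    moreover have "count_list (replicate m j) j = m" for m by (induction m) auto
    ultimately show ?thesis using True by simp
  qed (use js that in \<open>simp add: count_notin\<close>)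
  then show ?case using js by (intro exI[of _ "replicate (k j) j @ js"]) auto
qed simp

lemma foldr_fdiff_prod:
  assumes "finite J"
  shows "set js \<subseteq> J \<Longrightarrow> foldr fdiff (map unit_vec js) (\<lambda>x. \<Prod>j\<in>J. h j (x j))
      = (\<lambda>x. \<Prod>j\<in>J. (fdiff 1 ^^ count_list js j) (h j) (x j))"
proof (induction js)
  case (Cons i js)
  define u where "u j = (fdiff 1 ^^ count_list js j) (h j)" for j
  have "(\<Prod>j\<in>J. u j ((x + unit_vec i) j)) = u i (x i + 1) * (\<Prod>j\<in>J - {i}. u j (x j))" for x
    using assms Cons.prems by (simp add: prod.remove[of J i] unit_vec_def)
  moreover have "(\<Prod>j\<in>J. (fdiff 1 ^^ count_list (i # js) j) (h j) (x j))
      = fdiff 1 (u i) (x i) * (\<Prod>j\<in>J - {i}. u j (x j))" for x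
  proof -
    have "(\<Prod>j\<in>J - {i}. (fdiff 1 ^^ count_list (i # js) j) (h j) (x j)) = (\<Prod>j\<in>J - {i}. u j (x j))"
      by (intro prod.cong) (auto simp: u_def)
    then show ?thesis
      using assms Cons.prems by (simp add: prod.remove[of J i] u_def)
  qed
  moreover have "(\<Prod>j\<in>J. u j (x j)) = u i (x i) * (\<Prod>j\<in>J - {i}. u j (x j))" for x
    using assms Cons.prems by (simp add: prod.remove[of J i])
  ultimately have "fdiff (unit_vec i) (\<lambda>x. \<Prod>j\<in>J. u j (x j)) x
      = (\<Prod>j\<in>J. (fdiff 1 ^^ count_list (i # js) j) (h j) (x j))" for x
    by (simp only: fdiff_def left_diff_distrib)
  moreover have "foldr fdiff (map unit_vec js) (\<lambda>x. \<Prod>j\<in>J. h j (x j)) = (\<lambda>x. \<Prod>j\<in>J. u j (x j))"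
    using Cons by (simp add: u_def)
  ultimately show ?case
    unfolding list.map foldr.simps o_apply by presburger
qed simp

text \<open>
  As long as \<open>x + k\<close> stays below \<open>q\<close>, the difference sees at most one point where the indicator is not
  zero, the end point, whose coefficient is 1.
\<close>

lemma fdiff_indicator_last_residue:
  fixes q x k :: nat
  defines "h \<equiv> (\<lambda>x. if x mod q = q - 1 then 1 else 0)"
  assumes "0 < q" "x + k \<le> q - 1"
  shows "(fdiff 1 ^^ k) h x = (if x + k = q - 1 then 1 else 0)"
  using assms(3)
proof (induction k arbitrary: x)
  case 0
  then show ?case using assms(2) by (simp add: h_def)
next
  case (Suc k)
  then show ?case by (auto simp: fdiff_def)
qed

section \<open>Transfer to maps between finite groups\<close>

definition residue :: "'i set \<Rightarrow> ('i \<Rightarrow> nat) \<Rightarrow> ('i \<Rightarrow> nat) \<Rightarrow> 'i \<Rightarrow> int" where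
  "residue J q x = (\<lambda>j\<in>J. int (x j) mod int (q j))"

lemma residue_in_carrier:
  assumes "\<And>j. j \<in> J \<Longrightarrow> 0 < q j"
  shows "residue J q x \<in> carrier (product_group J (\<lambda>j. integer_mod_group (q j)))"
  using assms by (auto simp: residue_def carrier_integer_mod_group)

lemma residue_add:
  "residue J q x \<otimes>\<^bsub>product_group J (\<lambda>j. integer_mod_group (q j))\<^esub> residue J q y = residue J q (x + y)"
  by (auto simp: residue_def fun_eq_iff mod_add_eq)

lemma residue_surj:
  assumes q: "\<And>j. j \<in> J \<Longrightarrow> 0 < q j"
    and y: "y \<in> carrier (product_group J (\<lambda>j. integer_mod_group (q j)))"
  obtains x where "\<And>i. i \<notin> J \<Longrightarrow> x i = 0" "y = residue J q x"
proof
  have "0 \<le> y j \<and> y j < int (q j)" if "j \<in> J" for j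
    using PiE_mem[OF y[unfolded carrier_product_group] that] q[OF that]
    by (simp add: carrier_integer_mod_group)
  moreover have "y j = undefined" if "j \<notin> J" for j
    using PiE_arb[OF y[unfolded carrier_product_group] that] .
  ultimately show "y = residue J q (\<lambda>j. if j \<in> J then nat (y j) else 0)"
    by (auto simp: residue_def restrict_def fun_eq_iff)
qed simp

lemma foldr_diff_op_residue:
  assumes M: "0 < M" and f: "\<And>x. f (residue J q x) = F x mod int M"
  shows "foldr (diff_op (product_group J (\<lambda>j. integer_mod_group (q j))) (integer_mod_group M))
             (map (residue J q) gs) f (residue J q x) = foldr fdiff gs F x mod int M"
proof (induction gs arbitrary: x)
  case (Cons g gs)
  let ?H = "foldr fdiff gs F"
  have "(?H (x + g) mod int M + (- (?H x mod int M)) mod int M) mod int M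
      = (?H (x + g) - ?H x) mod int M"
    by (simp add: mod_simps)
  moreover have "?H x mod int M \<in> carrier (integer_mod_group M)"
    using M by (simp add: carrier_integer_mod_group)
  moreover have "diff_op (product_group J (\<lambda>j. integer_mod_group (q j))) (integer_mod_group M)
        (residue J q g) G (residue J q x)
      = (G (residue J q (x + g)) + inv\<^bsub>integer_mod_group M\<^esub> G (residue J q x)) mod int M" for G
    by (simp only: diff_op_def residue_add mult_integer_mod_group)
  moreover have "fdiff g ?H x = ?H (x + g) - ?H x"
    by (simp only: fdiff_def)
  ultimately show ?case
    by (simp only: list.map foldr.simps o_apply Cons.IH inv_integer_mod_group)
qed (simp add: f)

text \<open>
  The directions on the right are supported in \<open>J\<close>, as outside \<open>J\<close> a step has no effect on residues and the
  lifts constructed by \<open>residue_surj\<close> vanish there.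
\<close>

lemma iterated_diffs_vanish_iff:
  assumes q: "\<And>j. j \<in> J \<Longrightarrow> 0 < q j" and M: "0 < M"
    and f: "\<And>x. f (residue J q x) = F x mod int M"
  shows "iterated_diffs_vanish (product_group J (\<lambda>j. integer_mod_group (q j))) (integer_mod_group M) k f
     \<longleftrightarrow> (\<forall>gs x. length gs = k \<longrightarrow> (\<forall>g\<in>set gs. \<forall>i. i \<notin> J \<longrightarrow> g i = 0) \<longrightarrow> int M dvd foldr fdiff gs F x)"
    (is "?L \<longleftrightarrow> ?R")
proof
  let ?A = "product_group J (\<lambda>j. integer_mod_group (q j))" and ?B = "integer_mod_group M"
  note fold = foldr_diff_op_residue[where f = f and F = F and J = J and q = q, OF M f]
  show ?R if L: ?L
  proof (intro allI impI)
    fix gs :: "('a \<Rightarrow> nat) list" and x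
    assume "length gs = k"
    then have "foldr (diff_op ?A ?B) (map (residue J q) gs) f (residue J q x) = 0"
      using L[unfolded iterated_diffs_vanish_def, rule_format, of "map (residue J q) gs" "residue J q x"]
        residue_in_carrier[where J = J and q = q, OF q]
      by (simp add: image_subset_iff del: carrier_product_group)
    then show "int M dvd foldr fdiff gs F x"
      by (simp add: fold dvd_eq_mod_eq_0)
  qed
  show ?L if R: ?R
    unfolding iterated_diffs_vanish_def
  proof (intro allI impI ballI)
    fix hs y
    assume hs: "length hs = k \<and> set hs \<subseteq> carrier ?A" and y: "y \<in> carrier ?A"
    have "\<forall>h\<in>set hs. \<exists>g. (\<forall>i. i \<notin> J \<longrightarrow> g i = 0) \<and> residue J q g = h"
      using hs residue_surj[of J q, OF q] by (metis subset_iff)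
    then obtain r where r: "\<And>h i. h \<in> set hs \<Longrightarrow> i \<notin> J \<Longrightarrow> r h i = 0"
      "\<And>h. h \<in> set hs \<Longrightarrow> residue J q (r h) = h"
      by metis
    obtain x where x: "y = residue J q x"
      using residue_surj[OF q y] by metis
    have "map (residue J q) (map r hs) = hs"
      using r by (auto intro: map_idI)
    then have "foldr (diff_op ?A ?B) hs f y = foldr fdiff (map r hs) F x mod int M"
      using fold[of "map r hs" x] x by simp
    also have "int M dvd foldr fdiff (map r hs) F x"
      by (rule R[rule_format]) (use hs r(1) in auto)
    then have "foldr fdiff (map r hs) F x mod int M = 0"
      by simp
    finally show "foldr (diff_op ?A ?B) hs f y = \<one>\<^bsub>?B\<^esub>"
      by simp
  qed
qed

lemma Fdeg_le:
  assumes "iterated_diffs_vanish A B (m + 1) f"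
  shows "Fdeg A B f \<le> enat m"
  using assms by (auto simp: Fdeg_def intro: Least_le)

text \<open>
  Vanishing of all differences of some order implies it for every higher order, so a single
  nonvanishing order \<open>m\<close> excludes all smaller degrees.
\<close>

lemma Fdeg_ge:
  assumes f: "f \<in> carrier A \<rightarrow> carrier B" and A: "group A" and B: "group B"
    and m: "\<not> iterated_diffs_vanish A B m f"
  shows "enat m \<le> Fdeg A B f"
proof -
  have mono: "iterated_diffs_vanish A B (Suc k) f" if k: "iterated_diffs_vanish A B k f" for k
    unfolding iterated_diffs_vanish_def
  proof (intro allI impI ballI)
    fix gs x assume gs: "length gs = Suc k \<and> set gs \<subseteq> carrier A" and x: "x \<in> carrier A"
    then obtain g hs where "gs = g # hs" "length hs = k" "g \<in> carrier A" "set hs \<subseteq> carrier A"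
      by (cases gs) auto
    then show "foldr (diff_op A B) gs f x = \<one>\<^bsub>B\<^esub>"
      using k x group.is_monoid[OF A] B
      by (auto simp: iterated_diffs_vanish_def diff_op_def monoid.m_closed group.r_inv group.is_monoid)
  qed
  have not_vanish: "\<not> iterated_diffs_vanish A B k f" if "k \<le> m" for k
    using that m by (induction rule: inc_induct) (auto dest: mono)
  have "m \<le> k" if "iterated_diffs_vanish A B (k + 1) f" for k
    using not_vanish[of "k + 1"] that by (cases "k + 1 \<le> m") auto
  then show ?thesis
    by (auto simp: Fdeg_def intro: LeastI2)
qed

section \<open>The maximal functional degree\<close>

theorem theorem5p2:
  fixes p n \<beta> :: nat and \<alpha> :: "nat \<Rightarrow> nat"
  assumes "prime p"
    and "n \<ge> 1"
    and "\<And>j. j \<in> {1..n} \<Longrightarrow> \<alpha> j \<ge> 1"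
    and "\<beta> \<ge> 1"
  shows "let A = product_group {1..n} (\<lambda>j. integer_mod_group (p ^ \<alpha> j));
             B = integer_mod_group (p ^ \<beta>);
             \<alpha>max = Max (\<alpha> ` {1..n});
             N = (\<Sum>j=1..n. p ^ \<alpha> j) - n + (\<beta> - 1) * (p - 1) * p ^ (\<alpha>max - 1)
         in (\<forall>f \<in> carrier A \<rightarrow> carrier B. Fdeg A B f \<le> enat N) \<and>
            (\<exists>f \<in> carrier A \<rightarrow> carrier B. Fdeg A B f = enat N)"
proof -
  define J where "J = {1..n}"
  define q where "q j = p ^ \<alpha> j" for j
  define A where "A = product_group J (\<lambda>j. integer_mod_group (q j))"
  define B where "B = integer_mod_group (p ^ \<beta>)"
  define a where "a = Max (\<alpha> ` J)"
  define \<phi> where "\<phi> = (p - 1) * p ^ (a - 1)"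
  define N where "N = (\<Sum>j\<in>J. q j) - card J + (\<beta> - 1) * (p - 1) * p ^ (a - 1)"
  have J: "finite J" "J \<noteq> {}"
    using assms(2) by (auto simp: J_def)
  have q: "0 < q j" for j
    using prime_gt_0_nat[OF assms(1)] by (simp add: q_def)
  have M: "0 < p ^ \<beta>"
    using prime_gt_0_nat[OF assms(1)] by simp
  have \<alpha>: "1 \<le> \<alpha> j" "\<alpha> j \<le> a" if "j \<in> J" for j
    using that J assms(3) by (auto simp: a_def J_def)
  have upper: "Fdeg A B f \<le> enat N" if f: "f \<in> carrier A \<rightarrow> carrier B" for f
  proof (rule Fdeg_le)
    define F where "F x = f (residue J q x)" for x
    have "F x \<in> carrier B" for x
      using f residue_in_carrier[of J q x] q by (auto simp: F_def A_def)
    then have lift: "f (residue J q x) = F x mod int (p ^ \<beta>)" for x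
      using M assms(4) by (auto simp: F_def B_def carrier_integer_mod_group)
    have per: "F (x(j := x j + p ^ \<alpha> j)) = F x" for j x
    proof -
      have "residue J q (x(j := x j + p ^ \<alpha> j)) = residue J q x"
        by (auto simp: residue_def q_def restrict_def fun_eq_iff)
      then show ?thesis by (simp add: F_def)
    qed
    have unit_dirs: "int (p ^ \<beta>) dvd foldr fdiff (map unit_vec js) F x"
      if "set js \<subseteq> J" "length js = N + 1" for js x
    proof -
      have "(\<Sum>j\<in>J. count_list js j) = N + 1"
        using that J by (simp add: sum_count_set)
      then have le: "\<beta> \<le> (\<Sum>j\<in>J. (count_list js j - p ^ (\<alpha> j - 1)) div ((p - 1) * p ^ (\<alpha> j - 1)))"
        using J \<alpha> assms(1) by (intro sum_valuations_ge[of p J \<alpha> a]) (auto simp: N_def q_def)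
      have "int p ^ (\<Sum>j\<in>J. (count_list js j - p ^ (\<alpha> j - 1)) div ((p - 1) * p ^ (\<alpha> j - 1)))
              dvd foldr fdiff (map unit_vec js) F x"
        by (rule prime_power_dvd_foldr_fdiff[where F = F]) (use assms(1) J(1) \<alpha>(1) per in blast)+
      with le_imp_power_dvd[OF le] show ?thesis
        unfolding of_nat_power by (rule dvd_trans)
    qed
    then show "iterated_diffs_vanish A B (N + 1) f"
      unfolding A_def B_def
        iterated_diffs_vanish_iff[where f = f and F = F and J = J and q = q, OF q M lift]
    proof (intro allI impI)
      fix gs :: "(nat \<Rightarrow> nat) list" and x
      assume "length gs = N + 1" "\<forall>g\<in>set gs. \<forall>i. i \<notin> J \<longrightarrow> g i = 0"
      then show "int (p ^ \<beta>) dvd foldr fdiff gs F x"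
        using J(1) unit_dirs
        by - (rule dvd_foldr_fdiff_if_dvd_unit_vecs[where J = J and k = "N + 1"], blast+)
    qed
  qed
  have lower: "\<exists>f \<in> carrier A \<rightarrow> carrier B. enat N \<le> Fdeg A B f"
  proof -
    \<comment> \<open>\<open>f\<close> is the indicator function of the point with all coordinates \<open>-1\<close>.\<close>
    define h where "h j x = (if x mod q j = q j - 1 then 1 else 0 :: int)" for j x
    define F where "F x = (\<Prod>j\<in>J. h j (x j))" for x
    define f where "f y = F (\<lambda>j. nat (y j)) mod int (p ^ \<beta>)" for y :: "nat \<Rightarrow> int"
    have f: "f \<in> carrier A \<rightarrow> carrier B"
      using M by (auto simp: f_def B_def carrier_integer_mod_group)
    have lift: "f (residue J q x) = F x mod int (p ^ \<beta>)" for x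
    proof -
      have "F (\<lambda>j. nat (residue J q x j)) = F x"
        unfolding F_def by (intro prod.cong) (auto simp: residue_def h_def nat_mod_distrib)
      then show ?thesis by (simp add: f_def)
    qed
    have "a \<in> \<alpha> ` J"
      unfolding a_def using J by (intro Max_in) auto
    then obtain j0 where j0: "j0 \<in> J" "\<alpha> j0 = a"
      by auto
    \<comment> \<open>The \<open>\<beta> - 1\<close> factors \<open>p\<close> are all spent where they pay for the most differences.\<close>
    define k where "k j = q j - 1 + (if j = j0 then (\<beta> - 1) * \<phi> else 0)" for j
    obtain js where js: "set js \<subseteq> J" "\<forall>j\<in>J. count_list js j = k j"
      using ex_list_with_counts[OF J(1)] by blast
    have "length js = (\<Sum>j\<in>J. k j)"
      using sum_count_set[OF js(1) J(1)] js(2) by simp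
    also have "\<dots> = (\<Sum>j\<in>J. q j - 1) + (\<beta> - 1) * \<phi>"
      using J(1) j0(1) by (simp add: k_def sum.distrib)
    also have "(\<Sum>j\<in>J. q j - 1) = (\<Sum>j\<in>J. q j) - card J"
      using q by (subst sum_subtractf_nat) (auto simp: Suc_le_eq)
    also have "\<dots> + (\<beta> - 1) * \<phi> = N"
      by (simp add: N_def \<phi>_def mult.assoc)
    finally have len: "length js = N" .
    define c where "c m = (fdiff 1 ^^ m) (h j0) 0" for m
    have last: "(fdiff 1 ^^ (q j - 1)) (h j) 0 = 1" for j
      using fdiff_indicator_last_residue[of "q j" 0 "q j - 1"] q by (simp add: h_def[abs_def])
    have "((+) 1 ^^ m) x = x + m" for m x :: nat
      by (induction m) auto
    then have "binomial_recurrence (q j0) (\<lambda>m. foldr fdiff (replicate m 1 @ []) (h j0) 0)"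
      by (intro binomial_recurrence_differences) (simp add: h_def)
    then have "binomial_recurrence (p ^ a) c"
      by (simp add: c_def[abs_def] foldr_fdiff_replicate q_def j0)
    moreover have "\<not> int p dvd c (p ^ a - 1)"
      using last[of j0] assms(1) by (auto simp: c_def q_def j0)
    ultimately have "\<not> int p ^ Suc (\<beta> - 1) dvd c (p ^ a - 1 + (\<beta> - 1) * \<phi>)"
      unfolding \<phi>_def using \<alpha>(1)[OF j0(1)] j0(2)
      by (intro power_not_dvd_if_binomial_recurrence[OF assms(1)]) auto
    moreover have "foldr fdiff (map unit_vec js) F (\<lambda>_. 0) = c (p ^ a - 1 + (\<beta> - 1) * \<phi>)"
    proof -
      have "foldr fdiff (map unit_vec js) F (\<lambda>_. 0) = (\<Prod>j\<in>J. (fdiff 1 ^^ k j) (h j) 0)"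
        using foldr_fdiff_prod[OF J(1) js(1), of h] js(2) unfolding F_def by simp
      also have "\<dots> = (fdiff 1 ^^ k j0) (h j0) 0 * (\<Prod>j\<in>J - {j0}. (fdiff 1 ^^ k j) (h j) 0)"
        using J(1) j0(1) by (rule prod.remove)
      also have "(\<Prod>j\<in>J - {j0}. (fdiff 1 ^^ k j) (h j) 0) = 1"
        using last by (intro prod.neutral) (simp add: k_def)
      finally show ?thesis
        by (simp add: c_def k_def q_def j0)
    qed
    ultimately have "\<not> int (p ^ \<beta>) dvd foldr fdiff (map unit_vec js) F (\<lambda>_. 0)"
      using assms(4) by simp
    moreover have "\<forall>g\<in>set (map unit_vec js). \<forall>i. i \<notin> J \<longrightarrow> g i = 0"
      using js(1) by (auto simp: unit_vec_def)
    ultimately have "\<not> iterated_diffs_vanish A B N f"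
      unfolding A_def B_def
        iterated_diffs_vanish_iff[where f = f and F = F and J = J and q = q, OF q M lift]
      using len by (metis length_map)
    then show ?thesis
      using f by (intro bexI[of _ f] Fdeg_ge) (auto simp: A_def B_def)
  qed
  have "(\<forall>f \<in> carrier A \<rightarrow> carrier B. Fdeg A B f \<le> enat N) \<and>
        (\<exists>f \<in> carrier A \<rightarrow> carrier B. Fdeg A B f = enat N)"
    using upper lower by (metis order_antisym)
  then show ?thesis
    by (simp add: A_def B_def N_def a_def q_def[abs_def] J_def Let_def)
qed

end
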